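(* Let $p$ be a prime and $n\ge k\ge 1$ integers such that $s(n,k)$ is a minimum zero case, and let $r=(n-k)/(p-1)$. Then \[ \nu_p(s(n,k))=\frac{\sigma_p(k-1)-\sigma_p(n-1)}{p-1} \] and \[ \epsilon_p(s(n,k))\equiv \epsilon_p\big((n-1)!/(k-1)!\big)\binom{k-1}{r} \pmod p. \]
   Context: $s(n,k)$ is the signed Stirling number of the first kind, defined by $x(x-1)\cdots(x-n+1)=\sum_k s(n,k)x^k$. $\nu_p$ is the $p$-adic valuation, $\sigma_p(m)$ the base-$p$ digit sum, and $\epsilon_p(x)=p^{-\nu_p(x)}x$ the unit part of a nonzero rational $x$. $s(n,k)$ is called a minimum zero case if $\nu_p(s(n,k))=(\sigma_p(k-1)-\sigma_p(n-1))/(p-1)$ (in this case $(p-1)\mid(n-k)$, so $r$ is a nonnegative integer). *)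

theory Defs
  imports
    "HOL-Computational_Algebra.Computational_Algebra"
    "HOL-Number_Theory.Cong"
    "HOL-Combinatorics.Stirling"
begin

text \<open>
  The library's \<open>stirling\<close> is the unsigned number; the signed one is taken here from its generating
  polynomial \<open>x (x - 1) \<cdots> (x - n + 1)\<close>.
\<close>
definition signed_stirling :: "nat \<Rightarrow> nat \<Rightarrow> int" where
  "signed_stirling n k = coeff (\<Prod>i<n. [:- int i, 1:]) k"

lemma signed_stirling_eq:
  "signed_stirling n k = (-1) ^ (n + k) * int (stirling n k)"
proof (induction n arbitrary: k)
  case 0
  show ?case by (cases k) (simp_all add: signed_stirling_def)
next
  case (Suc n)
  have step: "(\<Prod>i<Suc n. [:- int i, 1:]) =
      smult (- int n) (\<Prod>i<n. [:- int i, 1:]) + pCons 0 (\<Prod>i<n. [:- int i, 1:])"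
    by (simp add: mult.commute)
  show ?case
  proof (cases k)
    case 0
    then show ?thesis
      using Suc.IH[of 0] unfolding signed_stirling_def step by (cases n) simp_all
  next
    case (Suc j)
    then show ?thesis
      using Suc.IH[of "Suc j"] Suc.IH[of j] unfolding signed_stirling_def step
      by (simp add: algebra_simps)
  qed
qed

lemma signed_stirling_nonzero:
  assumes "1 \<le> k" "k \<le> n"
  shows "signed_stirling n k \<noteq> 0"
proof -
  have "0 < stirling n k" using assms
  proof (induction n arbitrary: k)
    case (Suc n)
    then obtain j where j: "k = Suc j" by (cases k) auto
    show ?case
    proof (cases "j = n")
      case True
      then show ?thesis using j by simp
    next
      case False
      then show ?thesis using j Suc.IH[of "Suc j"] Suc.prems by simp
    qed
  qed simp
  then show ?thesis by (simp add: signed_stirling_eq)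
qed

text \<open>Only meaningful for \<open>x \<noteq> 0\<close>; at \<open>0\<close>, where the valuation is infinite, the value is \<open>0\<close>.\<close>
definition padic_val :: "nat \<Rightarrow> rat \<Rightarrow> int" where
  "padic_val p x = int (multiplicity (int p) (fst (quotient_of x)))
                 - int (multiplicity (int p) (snd (quotient_of x)))"

lemma padic_val_of_int [simp]: "padic_val p (of_int a) = int (multiplicity (int p) a)"
  by (simp add: padic_val_def)

definition unit_part :: "nat \<Rightarrow> rat \<Rightarrow> rat" where
  "unit_part p x = of_nat p powi (- padic_val p x) * x"

text \<open>For \<open>p \<ge> 2\<close> the digits at positions \<open>i > m\<close> vanish, so the bound \<open>m\<close> loses none of them.\<close>
definition digit_sum :: "nat \<Rightarrow> nat \<Rightarrow> nat" where
  "digit_sum p m = (\<Sum>i\<le>m. m div p ^ i mod p)"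

text \<open>Congruence modulo \<open>p\<close> of rationals: the difference lies in \<open>p\<int>\<^sub>(\<^sub>p\<^sub>)\<close>.\<close>
definition rat_cong :: "rat \<Rightarrow> rat \<Rightarrow> nat \<Rightarrow> bool" where
  "rat_cong x y p \<longleftrightarrow>
     (\<exists>a b :: int. \<not> int p dvd b \<and> x - y = of_nat p * (of_int a / of_int b))"

lemma rat_cong_of_int:
  assumes "prime p"
  shows "rat_cong (of_int x) (of_int y) p \<longleftrightarrow> [x = y] (mod int p)"
proof
  assume "rat_cong (of_int x) (of_int y) p"
  then obtain a b :: int where b: "\<not> int p dvd b"
    and eq: "(of_int x - of_int y :: rat) = of_nat p * (of_int a / of_int b)"
    unfolding rat_cong_def by blast
  from b have "b \<noteq> 0" by auto
  with eq have "(of_int ((x - y) * b) :: rat) = of_int (int p * a)"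
    by (simp add: field_simps)
  then have "(x - y) * b = int p * a" by (simp only: of_int_eq_iff)
  then have "int p dvd (x - y) * b" by simp
  with b assms have "int p dvd x - y"
    by (simp add: prime_dvd_mult_iff)
  then show "[x = y] (mod int p)" by (simp add: cong_iff_dvd_diff)
next
  assume "[x = y] (mod int p)"
  then obtain a where a: "x - y = int p * a" by (auto simp: cong_iff_dvd_diff)
  have "\<not> int p dvd 1" using assms prime_gt_1_nat[of p] by auto
  moreover have "(of_int x - of_int y :: rat) = of_nat p * (of_int a / of_int 1)"
    using arg_cong[OF a, of "of_int :: int \<Rightarrow> rat"] by simp
  ultimately show "rat_cong (of_int x) (of_int y) p"
    unfolding rat_cong_def by blast
qed

definition minimum_zero_case :: "nat \<Rightarrow> nat \<Rightarrow> nat \<Rightarrow> bool" where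
  "minimum_zero_case p n k \<longleftrightarrow>
     (of_int (padic_val p (of_int (signed_stirling n k))) :: rat) =
     (of_nat (digit_sum p (k - 1)) - of_nat (digit_sum p (n - 1))) / (of_nat p - 1)"

lemma digit_sum_cong:
  assumes "p \<ge> 2"
  shows "[int (digit_sum p m) = int m] (mod (int p - 1))"
proof -
  have exp: "int m = (\<Sum>i<N. int (m div p ^ i mod p) * int p ^ i) + int (m div p ^ N) * int p ^ N"
    for N
  proof (induction N)
    case (Suc N)
    have "m div p ^ N = m div p ^ N div p * p + m div p ^ N mod p" by simp
    moreover have "m div p ^ N div p = m div p ^ Suc N"
      by (simp add: div_mult2_eq mult.commute[of p])
    ultimately have "int (m div p ^ N) = int (m div p ^ Suc N) * int p + int (m div p ^ N mod p)"
      by (metis of_nat_add of_nat_mult)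
    then show ?case using Suc.IH by (simp add: algebra_simps)
  qed simp
  have "m < p ^ Suc m"
    using assms less_exp[of "Suc m"] power_mono[of 2 p "Suc m"] by linarith
  then have "int m = (\<Sum>i\<le>m. int (m div p ^ i mod p) * int p ^ i)"
    using exp[of "Suc m"] by (simp add: lessThan_Suc_atMost)
  moreover have "[(\<Sum>i\<le>m. int (m div p ^ i mod p) * int p ^ i) =
                  (\<Sum>i\<le>m. int (m div p ^ i mod p) * 1)] (mod (int p - 1))"
  proof (intro cong_sum cong_mult cong_refl)
    fix i
    have "[int p = 1] (mod (int p - 1))" by (simp add: cong_iff_dvd_diff)
    from cong_pow[OF this, of i] show "[int p ^ i = 1] (mod (int p - 1))" by simp
  qed
  ultimately show ?thesis by (simp add: digit_sum_def cong_sym)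
qed

text \<open>Hence \<open>(n - k) div (p - 1)\<close> is the exact quotient in a minimum zero case.\<close>
lemma minimum_zero_case_dvd:
  assumes "prime p" "1 \<le> k" "k \<le> n" "minimum_zero_case p n k"
  shows "(p - 1) dvd (n - k)"
proof -
  have p: "p \<ge> 2" using assms(1) by (rule prime_ge_2_nat)
  define v where "v = padic_val p (of_int (signed_stirling n k))"
  have "(of_nat p - 1 :: rat) \<noteq> 0" using p by auto
  then have "(of_int (v * (int p - 1)) :: rat) =
      of_int (int (digit_sum p (k - 1)) - int (digit_sum p (n - 1)))"
    using assms(4) unfolding minimum_zero_case_def v_def[symmetric] by (simp add: field_simps)
  then have "v * (int p - 1) = int (digit_sum p (k - 1)) - int (digit_sum p (n - 1))"
    by (simp only: of_int_eq_iff)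
  then have "[int (digit_sum p (n - 1)) = int (digit_sum p (k - 1))] (mod (int p - 1))"
    by (metis cong_iff_dvd_diff cong_sym dvd_triv_right)
  then have "[int (n - 1) = int (k - 1)] (mod (int p - 1))"
    using digit_sum_cong[OF p] cong_sym cong_trans by metis
  then have "int (p - 1) dvd int (n - k)"
    using p assms(2,3) by (simp add: cong_iff_dvd_diff of_nat_diff)
  then show ?thesis by (simp only: of_nat_dvd_iff)
qed

end

theory Submission
  imports Defs
begin

text \<open>
  Differentiating \<open>log(1 + t)\<^sup>k / k! = \<Sum>\<^sub>n s(n, k) t\<^sup>n / n!\<close> gives
  \<open>s(n, k) = (n-1)!/(k-1)! a\<close>, where \<open>a\<close> is the coefficient of \<open>t\<^sup>n\<^sup>-\<^sup>k\<close> in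
  \<open>(log(1 + t)/t)\<^sup>k\<^sup>-\<^sup>1 / (1 + t)\<close>. In \<open>log(1 + t)/t = \<Sum>\<^sub>i (-t)\<^sup>i/(i+1)\<close> the coefficient of
  \<open>t\<^sup>i\<close> has valuation at least \<open>-i/(p-1)\<close>, with equality only for \<open>i = 0\<close> and \<open>i = p - 1\<close>.
  So after rescaling \<open>t\<close> the series reduces to \<open>(1 + t\<^sup>p\<^sup>-\<^sup>1)\<^sup>k\<^sup>-\<^sup>1\<close> modulo \<open>p\<close>, that is,
  \<open>p\<^sup>r a\<close> is congruent to \<open>k - 1\<close> choose \<open>r\<close>. By Legendre's formula \<open>p\<^sup>-\<^sup>r (n-1)!/(k-1)!\<close> has the
  valuation prescribed for \<open>s(n, k)\<close> in a minimum zero case.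
\<close>

section \<open>A generating function\<close>

lemma signed_stirling_Suc_Suc:
  "signed_stirling (Suc n) (Suc k) = signed_stirling n k - int n * signed_stirling n (Suc k)"
  by (simp add: signed_stirling_eq algebra_simps)

text \<open>Write \<open>G j\<close> for \<open>log(1 + X)^j / (1 + X)\<close>. Differentiating
  \<open>(1 + X) * G j = log(1 + X)^j\<close> yields \<open>j * G (j - 1)\<close>; comparing
  coefficients of \<open>X^m\<close> gives the Stirling recurrence, up to the factorials.\<close>

lemma fps_ln_power_over_1_plus_X_nth:
  "(fps_ln 1 ^ j * inverse (1 + fps_X)) $ m =
     (of_int (signed_stirling (Suc m) (Suc j)) * fact j / fact m :: rat)"
proof (induction m arbitrary: j)
  case 0
  show ?case
    by (cases j) (simp_all add: signed_stirling_eq power_0_left)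
next
  case (Suc m)
  define G where "G j = fps_ln 1 ^ j * inverse (1 + fps_X :: rat fps)" for j
  have "(1 + fps_X) * G j = fps_ln 1 ^ j * ((1 + fps_X) * inverse (1 + fps_X))"
    unfolding G_def by (rule mult.left_commute)
  also have "(1 + fps_X :: rat fps) * inverse (1 + fps_X) = 1"
    by (simp add: inverse_mult_eq_1')
  finally have "fps_deriv ((1 + fps_X) * G j) = fps_deriv (fps_ln 1 ^ j)"
    by (simp only: mult_1_right)
  also have "\<dots> = of_nat j * G (j - 1)"
    by (simp add: fps_deriv_power' fps_ln_deriv G_def mult_ac)
  finally have "fps_deriv ((1 + fps_X) * G j) = of_nat j * G (j - 1)" .
  then have "fps_deriv ((1 + fps_X) * G j) $ m = of_nat j * G (j - 1) $ m"
    by (simp add: fps_mult_of_nat_nth)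
  then have "of_nat (Suc m) * (G j $ Suc m + G j $ m) = of_nat j * G (j - 1) $ m"
    by (simp add: distrib_right fps_deriv_nth del: fps_deriv_mult fps_deriv_add)
  then have rec: "G j $ Suc m = of_nat j * G (j - 1) $ m / of_nat (Suc m) - G j $ m"
    by (simp add: field_simps del: of_nat_Suc)
  \<comment> \<open>Here \<open>M\<close>, \<open>a\<close>, \<open>b\<close>, \<open>I\<close>
    stand for \<open>m + 1\<close>, \<open>m!\<close>, \<open>i!\<close>, \<open>i + 1\<close>, and
    \<open>x\<close>, \<open>y\<close> for the two Stirling numbers of the recurrence.\<close>
  have alg: "I * (x * b / a) / M - y * (I * b) / a = (x - M * y) * (I * b) / (M * a)"
    if "M \<noteq> 0" "a \<noteq> 0" for I M a b x y :: rat
    using that by (simp add: field_simps)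
  show ?case
  proof (cases j)
    \<comment> \<open>The truncated \<open>j - 1\<close> does no harm, as its factor
      \<open>of_nat j\<close> is 0; likewise \<open>s(m + 1, 0) = 0\<close>.\<close>
    case 0
    then show ?thesis
      using rec Suc.IH[of 0] signed_stirling_Suc_Suc[of "Suc m" 0]
      by (simp add: G_def signed_stirling_eq[of "Suc m" 0] del: of_nat_Suc)
  next
    case (Suc i)
    have "G j $ Suc m = of_nat (Suc i) * (of_int (signed_stirling (Suc m) (Suc i)) * fact i / fact m)
        / of_nat (Suc m) - of_int (signed_stirling (Suc m) (Suc (Suc i))) * fact (Suc i) / fact m"
      using rec Suc.IH[of i] Suc.IH[of "Suc i"] Suc by (simp only: G_def diff_Suc_1)
    also have "\<dots> = of_int (signed_stirling (Suc (Suc m)) (Suc (Suc i))) * fact (Suc i) / fact (Suc m)"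
      unfolding signed_stirling_Suc_Suc[of "Suc m"] fact_Suc
      by (subst alg) (simp_all del: of_nat_Suc)
    finally show ?thesis using Suc by (simp add: G_def)
  qed
qed

section \<open>Congruences between \<open>p\<close>-integral rationals\<close>

text \<open>The localization of the integers at \<open>p\<close>, with fractions in the same form as
  in \<open>rat_cong\<close>.\<close>

definition p_integral :: "nat \<Rightarrow> rat \<Rightarrow> bool" where
  "p_integral p x \<longleftrightarrow> (\<exists>a b :: int. \<not> int p dvd b \<and> x = of_int a / of_int b)"

lemma rat_cong_iff_p_integral:
  "rat_cong x y p \<longleftrightarrow> (\<exists>z. p_integral p z \<and> x - y = of_nat p * z)"
  unfolding rat_cong_def p_integral_def by blast

lemma p_integral_of_int [simp]: "prime p \<Longrightarrow> p_integral p (of_int a)"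
  unfolding p_integral_def
  by (rule exI[of _ a], rule exI[of _ 1]) (auto dest: prime_gt_1_nat)

lemma p_integral_of_nat [simp]: "prime p \<Longrightarrow> p_integral p (of_nat a)"
  using p_integral_of_int[of p "int a"] by simp

lemma p_integral_0 [simp]: "prime p \<Longrightarrow> p_integral p 0"
  using p_integral_of_int[of p 0] by simp

lemma p_integral_add:
  assumes "prime p" "p_integral p x" "p_integral p y"
  shows "p_integral p (x + y)"
proof -
  obtain a b c d :: int where
    h: "\<not> int p dvd b" "x = of_int a / of_int b" "\<not> int p dvd d" "y = of_int c / of_int d"
    using assms(2,3) unfolding p_integral_def by blast
  have "b \<noteq> 0" "d \<noteq> 0" using h by auto
  then have "x + y = of_int (a * d + c * b) / of_int (b * d)"
    using h by (simp add: field_simps)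
  moreover have "\<not> int p dvd b * d"
    using h assms(1) by (simp add: prime_dvd_mult_iff)
  ultimately show ?thesis unfolding p_integral_def by blast
qed

lemma p_integral_mult:
  assumes "prime p" "p_integral p x" "p_integral p y"
  shows "p_integral p (x * y)"
proof -
  obtain a b c d :: int where
    h: "\<not> int p dvd b" "x = of_int a / of_int b" "\<not> int p dvd d" "y = of_int c / of_int d"
    using assms(2,3) unfolding p_integral_def by blast
  then have "x * y = of_int (a * c) / of_int (b * d)"
    by simp
  moreover have "\<not> int p dvd b * d"
    using h assms(1) by (simp add: prime_dvd_mult_iff)
  ultimately show ?thesis unfolding p_integral_def by blast
qed

lemma p_integral_sum:
  assumes "prime p" "\<And>i. i \<in> A \<Longrightarrow> p_integral p (f i)"
  shows "p_integral p (sum f A)"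
  using assms(2)
  by (induction A rule: infinite_finite_induct) (auto intro: p_integral_add simp: assms(1))

lemma p_integral_power: "prime p \<Longrightarrow> p_integral p (of_nat p ^ n)"
  using p_integral_of_nat[of p "p ^ n"] by simp

lemma rat_cong_refl: "prime p \<Longrightarrow> rat_cong x x p"
  unfolding rat_cong_iff_p_integral by (rule exI[of _ 0]) simp

lemma rat_cong_0: "prime p \<Longrightarrow> p_integral p x \<Longrightarrow> rat_cong (of_nat p * x) 0 p"
  unfolding rat_cong_iff_p_integral by auto

lemma rat_cong_add:
  assumes "prime p" "rat_cong x y p" "rat_cong x' y' p"
  shows "rat_cong (x + x') (y + y') p"
proof -
  obtain z z' where "p_integral p z" "x - y = of_nat p * z"
      "p_integral p z'" "x' - y' = of_nat p * z'"
    using assms(2,3) unfolding rat_cong_iff_p_integral by blast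
  then show ?thesis unfolding rat_cong_iff_p_integral
    by (intro exI[of _ "z + z'"]) (simp add: p_integral_add assms(1) algebra_simps)
qed

lemma rat_cong_sum:
  assumes "prime p" "\<And>i. i \<in> A \<Longrightarrow> rat_cong (f i) (g i) p"
  shows "rat_cong (sum f A) (sum g A) p"
  using assms(2)
  by (induction A rule: infinite_finite_induct) (auto intro: rat_cong_add rat_cong_refl assms(1))

lemma rat_cong_mult_left:
  assumes "prime p" "p_integral p u" "rat_cong x y p"
  shows "rat_cong (u * x) (u * y) p"
proof -
  obtain z where "p_integral p z" "x - y = of_nat p * z"
    using assms(3) unfolding rat_cong_iff_p_integral by blast
  then show ?thesis unfolding rat_cong_iff_p_integral
    by (intro exI[of _ "u * z"]) (simp add: p_integral_mult assms right_diff_distrib[symmetric])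
qed

lemma rat_cong_trans:
  assumes "prime p" "rat_cong x y p" "rat_cong y z p"
  shows "rat_cong x z p"
proof -
  \<comment> \<open>The difference of the two sums is \<open>x - z\<close>.\<close>
  have "rat_cong (x + y) (y + z) p" by (rule rat_cong_add) fact+
  then show ?thesis by (simp add: rat_cong_def)
qed

lemma p_integral_rat_cong:
  assumes "prime p" "p_integral p x" "rat_cong x y p"
  shows "p_integral p y"
proof -
  obtain z where z: "p_integral p z" "x - y = of_nat p * z"
    using assms(3) unfolding rat_cong_iff_p_integral by blast
  then have y: "y = x + of_int (- int p) * z" by simp
  show ?thesis unfolding y
    by (intro p_integral_add p_integral_mult p_integral_of_int assms z)
qed

lemma rat_cong_mult:
  assumes "prime p" "p_integral p x" "p_integral p x'" "rat_cong x y p" "rat_cong x' y' p"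
  shows "rat_cong (x * x') (y * y') p"
proof (rule rat_cong_trans)
  show "rat_cong (x * x') (x * y') p" by (rule rat_cong_mult_left) fact+
  have "p_integral p y'" using assms(1,3,5) by (rule p_integral_rat_cong)
  from rat_cong_mult_left[OF assms(1) this assms(4)]
  show "rat_cong (x * y') (y * y') p" by (simp add: mult.commute)
qed fact

section \<open>Reduction of power series\<close>

text \<open>
  With \<open>\<pi>\<^sup>p\<^sup>-\<^sup>1 = p\<close>, the series \<open>G(\<pi> t)\<close> has integral coefficients and its reduction modulo \<open>\<pi>\<close>
  is \<open>c(t\<^sup>p\<^sup>-\<^sup>1)\<close>. The exponent \<open>i div (p - 1)\<close> avoids the ramified extension.
\<close>
definition reduces_to :: "nat \<Rightarrow> rat fps \<Rightarrow> rat fps \<Rightarrow> bool" where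
  "reduces_to p G c \<longleftrightarrow>
     (\<forall>i. p_integral p (of_nat p ^ (i div (p - 1)) * G $ i)) \<and>
     (\<forall>r. rat_cong (of_nat p ^ r * G $ (r * (p - 1))) (c $ r) p)"

lemma div_add_div_le: "(a div d) + (b div d) \<le> (a + b) div (d :: nat)"
  by (subst div_add1_eq) (rule le_add1)

text \<open>In degree \<open>r * e\<close> of the Cauchy product, with \<open>e = p - 1\<close>, a
  term whose index is not a multiple of \<open>e\<close> keeps a spare factor \<open>p\<close> and
  vanishes modulo \<open>p\<close>. The indices \<open>q * e\<close> give the Cauchy product of
  \<open>c\<close> and \<open>d\<close> in degree \<open>r\<close>.\<close>

lemma reduces_to_mult:
  assumes p: "prime p" and G: "reduces_to p G c" and H: "reduces_to p H d"
  shows "reduces_to p (G * H) (c * d)"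
proof -
  define e where "e = p - 1"
  have e: "e > 0" using prime_gt_1_nat[OF p] by (simp add: e_def)
  have GI: "p_integral p (of_nat p ^ (i div e) * G $ i)"
    and HI: "p_integral p (of_nat p ^ (i div e) * H $ i)" for i
    using G H by (auto simp: reduces_to_def e_def)
  have GC: "rat_cong (of_nat p ^ q * G $ (q * e)) (c $ q) p"
    and HC: "rat_cong (of_nat p ^ q * H $ (q * e)) (d $ q) p" for q
    using G H by (auto simp: reduces_to_def e_def)
  have split: "of_nat p ^ N * (G $ i * H $ j) =
      of_nat p ^ (N - (i div e + j div e)) *
        ((of_nat p ^ (i div e) * G $ i) * (of_nat p ^ (j div e) * H $ j))"
    if "i div e + j div e \<le> N" for i j N
  proof -
    have "(of_nat p :: rat) ^ N =
        of_nat p ^ (N - (i div e + j div e)) * of_nat p ^ (i div e) * of_nat p ^ (j div e)"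
      using that by (simp add: power_add[symmetric])
    then show ?thesis by (simp only: mult_ac)
  qed
  have int: "p_integral p (of_nat p ^ N * (G $ i * H $ j))" if "i div e + j div e \<le> N" for i j N
    unfolding split[OF that]
    by (rule p_integral_mult[OF p p_integral_power[OF p] p_integral_mult[OF p GI HI]])
  have "p_integral p (of_nat p ^ (N div e) * (G * H) $ N)" for N
    unfolding fps_mult_nth sum_distrib_left
  proof (rule p_integral_sum[OF p])
    fix i assume "i \<in> {0..N}"
    then have "i div e + (N - i) div e \<le> N div e"
      using div_add_div_le[of i e "N - i"] by simp
    then show "p_integral p (of_nat p ^ (N div e) * (G $ i * H $ (N - i)))"
      by (rule int)
  qed
  moreover have "rat_cong (of_nat p ^ r * (G * H) $ (r * e)) ((c * d) $ r) p" for r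
  proof -
    define t where "t i = of_nat p ^ r * (G $ i * H $ (r * e - i))" for i
    define M where "M = (\<lambda>q. q * e) ` {0..r}"
    have sub: "M \<subseteq> {0..r * e}" by (auto simp: M_def)
    have "of_nat p ^ r * (G * H) $ (r * e) = sum t {0..r * e}"
      by (simp add: fps_mult_nth sum_distrib_left t_def)
    also have "\<dots> = sum t ({0..r * e} - M) + sum t M"
      by (rule sum.subset_diff[OF sub]) simp
    also have "sum t M = (\<Sum>q=0..r. t (q * e))"
      unfolding M_def using e by (subst sum.reindex) (auto simp: inj_on_def)
    finally have eq: "of_nat p ^ r * (G * H) $ (r * e) =
        sum t ({0..r * e} - M) + (\<Sum>q=0..r. t (q * e))" .
    have "rat_cong (sum t ({0..r * e} - M)) (\<Sum>i\<in>{0..r * e} - M. 0) p"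
    proof (rule rat_cong_sum[OF p])
      fix i assume i: "i \<in> {0..r * e} - M"
      have nd: "i mod e \<noteq> 0"
      proof
        assume "i mod e = 0"
        then have "i = (i div e) * e" by (simp add: mod_0_imp_dvd)
        moreover have "i div e \<le> r" using i e div_le_mono[of i "r * e" e] by simp
        ultimately have "i \<in> M" unfolding M_def by auto
        with i show False by simp
      qed
      \<comment> \<open>Strictness comes from the positive remainder of \<open>i\<close> modulo
        \<open>e\<close>: the two floors add up to at most \<open>r - 1\<close>, which leaves one
        factor \<open>p\<close> outside \<open>z\<close>.\<close>
      have "(i div e + (r * e - i) div e) * e < r * e"
      proof -
        have "i div e * e < i" using nd div_mult_mod_eq[of i e] by linarith
        moreover have "(r * e - i) div e * e \<le> r * e - i" by simp
        moreover have "i \<le> r * e" using i by simp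
        ultimately show ?thesis by (simp only: add_mult_distrib)
      qed
      then have lt: "i div e + (r * e - i) div e < r" by simp
      define z where "z = of_nat p ^ (r - 1) * (G $ i * H $ (r * e - i))"
      have "i div e + (r * e - i) div e \<le> r - 1" using lt by simp
      then have "p_integral p z" unfolding z_def by (rule int)
      moreover have "t i = of_nat p * z"
        using lt by (cases r) (simp_all add: t_def z_def)
      ultimately show "rat_cong (t i) 0 p" using rat_cong_0[OF p] by simp
    qed
    moreover have "rat_cong (\<Sum>q=0..r. t (q * e)) (\<Sum>q=0..r. c $ q * d $ (r - q)) p"
    proof (rule rat_cong_sum[OF p])
      fix q assume "q \<in> {0..r}"
      then have q: "q \<le> r" by simp
      have re: "r * e - q * e = (r - q) * e" by (simp add: diff_mult_distrib)
      have "t (q * e) = (of_nat p ^ q * G $ (q * e)) * (of_nat p ^ (r - q) * H $ ((r - q) * e))"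
        unfolding t_def re using split[of "q * e" "(r - q) * e" r] q e by simp
      moreover have "p_integral p (of_nat p ^ q * G $ (q * e))"
        "p_integral p (of_nat p ^ (r - q) * H $ ((r - q) * e))"
        using GI[of "q * e"] HI[of "(r - q) * e"] e by simp_all
      ultimately show "rat_cong (t (q * e)) (c $ q * d $ (r - q)) p"
        by (simp only: rat_cong_mult[OF p _ _ GC HC])
    qed
    ultimately have "rat_cong (of_nat p ^ r * (G * H) $ (r * e))
        ((\<Sum>i\<in>{0..r * e} - M. 0) + (\<Sum>q=0..r. c $ q * d $ (r - q))) p"
      unfolding eq by (rule rat_cong_add[OF p])
    then show ?thesis by (simp add: fps_mult_nth)
  qed
  ultimately show ?thesis by (simp add: reduces_to_def e_def)
qed

section \<open>Reductions of \<open>log(1 + t)/t\<close> and \<open>1/(1 + t)\<close>\<close>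

lemma multiplicity_mult_pred_less:
  assumes "prime p" "m > 0"
  shows "multiplicity p m * (p - 1) < (m :: nat)"
proof -
  define v where "v = multiplicity p m"
  \<comment> \<open>Bernoulli's inequality for \<open>(1 + (p - 1))^v\<close>, to be combined with
    \<open>p^v\<close> dividing \<open>m\<close>.\<close>
  have "real v * (real p - 1) + 1 \<le> real p ^ v"
    using Bernoulli_inequality[of "real p - 1" v] by simp
  moreover have "real (p - 1) = real p - 1" using prime_gt_1_nat[OF assms(1)] by simp
  ultimately have "real (v * (p - 1) + 1) \<le> real (p ^ v)" by simp
  then have "v * (p - 1) + 1 \<le> p ^ v" by (simp only: of_nat_le_iff)
  also have "p ^ v \<le> m"
    unfolding v_def using multiplicity_dvd[of p m] assms(2) by (rule dvd_imp_le)
  finally show ?thesis by (simp add: v_def)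
qed

lemma p_integral_power_over_nat:
  assumes "prime p" "m > 0" "multiplicity p m \<le> v"
  shows "p_integral p (of_nat p ^ v / of_nat m)"
proof -
  obtain u where u: "m = p ^ multiplicity p m * u" "\<not> p dvd u"
    using multiplicity_decompose'[of m p] assms prime_gt_1_nat[of p] by auto
  have "(of_nat p :: rat) ^ v = of_nat p ^ (v - multiplicity p m) * of_nat p ^ multiplicity p m"
    using assms(3) by (simp add: power_add[symmetric])
  moreover have "(of_nat m :: rat) = of_nat p ^ multiplicity p m * of_nat u"
    by (metis u(1) of_nat_mult of_nat_power)
  moreover have "p \<noteq> 0" using assms(1) by auto
  ultimately have "of_nat p ^ v / of_nat m =
      (of_int (int (p ^ (v - multiplicity p m))) / of_int (int u) :: rat)"
    by (simp add: field_simps)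
  moreover have "\<not> int p dvd int u" using u(2) by simp
  ultimately show ?thesis unfolding p_integral_def by blast
qed

text \<open>A strict form of Bernoulli's inequality. It shows that the denominator
  \<open>r * (p - 1) + 1\<close> has valuation below \<open>r\<close>, so that the reduction of
  \<open>log(1 + t)/t\<close> has no terms beyond \<open>r = 1\<close>.\<close>

lemma mult_pred_less_power:
  assumes "r \<ge> 2" "p \<ge> (2 :: nat)"
  shows "r * (p - 1) + 1 < p ^ r"
  using assms(1)
proof (induction r rule: dec_induct)
  case base
  define e where "e = p - 1"
  have "p = e + 1" "e \<ge> 1" using assms(2) by (simp_all add: e_def)
  then show ?case by (simp add: power2_eq_square)
next
  case (step r)
  have "Suc r * (p - 1) + 1 \<le> p * (r * (p - 1) + 1)"
  proof -
    define e where "e = p - 1"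
    have "p = e + 1" using assms(2) by (simp add: e_def)
    then show ?thesis by (simp add: algebra_simps)
  qed
  also have "\<dots> < p * p ^ r" using step.IH assms(2) by (intro mult_strict_left_mono) simp_all
  finally show ?case by simp
qed

lemma reduces_to_ln_over_X:
  assumes p: "prime p"
  shows "reduces_to p (Abs_fps (\<lambda>i. (-1) ^ i / of_nat (Suc i))) (1 + fps_X)"
proof -
  have p2: "p \<ge> 2" using p by (rule prime_ge_2_nat)
  have le: "multiplicity p (Suc i) \<le> i div (p - 1)" for i
    using multiplicity_mult_pred_less[OF p, of "Suc i"] p2
    by (simp add: less_eq_div_iff_mult_less_eq)
  have sgn: "p_integral p ((-1) ^ i)" for i
    using p_integral_of_int[OF p, of "(-1) ^ i"] by simp
  have "p_integral p (of_nat p ^ (i div (p - 1)) * ((-1) ^ i / of_nat (Suc i)))" for i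
  proof -
    have "p_integral p ((-1) ^ i * (of_nat p ^ (i div (p - 1)) / of_nat (Suc i)))"
      by (intro p_integral_mult p sgn p_integral_power_over_nat le) simp
    then show ?thesis by (simp only: times_divide_eq_right mult.commute)
  qed
  moreover have "rat_cong (of_nat p ^ r * ((-1) ^ (r * (p - 1)) / of_nat (Suc (r * (p - 1)))))
      ((1 + fps_X) $ r) p" for r
  proof -
    consider "r = 0" | "r = 1" | "r \<ge> 2" by linarith
    then show ?thesis
    proof cases
      case 1
      then show ?thesis by (simp add: rat_cong_refl p)
    next
      case 2
      have "rat_cong ((-1) ^ (p - 1)) 1 p"
      \<comment> \<open>For \<open>p = 2\<close> the sign is -1, which is congruent to 1 modulo
        2.\<close>
      proof (cases "p = 2")
        case True
        then show ?thesis
          using rat_cong_of_int[OF p, of "-1" 1] by (simp add: cong_iff_dvd_diff)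
      next
        case False
        then have "even (p - 1)" using p prime_odd_nat[of p] p2 by simp
        then show ?thesis by (simp add: rat_cong_refl p)
      qed
      moreover have "Suc (p - 1) = p" "p \<noteq> 0" using p2 by simp_all
      ultimately show ?thesis using 2 by simp
    next
      case 3
      define m where "m = Suc (r * (p - 1))"
      have "p ^ multiplicity p m \<le> m"
        using multiplicity_dvd[of p m] by (rule dvd_imp_le) (simp add: m_def)
      also have "\<dots> < p ^ r" using mult_pred_less_power[OF 3 p2] by (simp add: m_def)
      finally have "multiplicity p m \<le> r - 1"
        using power_less_imp_less_exp[of p "multiplicity p m" r] p2 by simp
      then have "p_integral p ((-1) ^ (r * (p - 1)) * (of_nat p ^ (r - 1) / of_nat m))"
        by (intro p_integral_mult p sgn p_integral_power_over_nat) (simp_all add: m_def)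
      from rat_cong_0[OF p this]
      have "rat_cong (of_nat p ^ r * ((-1) ^ (r * (p - 1)) / of_nat m)) 0 p"
        using 3 by (cases r) (simp_all add: mult_ac)
      then show ?thesis using 3 by (simp add: m_def)
    qed
  qed
  ultimately show ?thesis by (simp add: reduces_to_def)
qed

text \<open>The coefficients are 1 and -1, so the weight \<open>p^r\<close> kills all but the
  constant term.\<close>

lemma reduces_to_inverse_1_plus_X:
  assumes p: "prime p"
  shows "reduces_to p (inverse (1 + fps_X)) 1"
proof -
  have p2: "p \<ge> 2" using p by (rule prime_ge_2_nat)
  have int: "p_integral p (of_nat p ^ q * (-1) ^ i)" for q i
    using p_integral_of_int[OF p, of "int p ^ q * (-1) ^ i"] by simp
  moreover have "rat_cong (of_nat p ^ r * (-1) ^ (r * (p - 1))) (1 $ r) p" for r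
  proof (cases r)
    case (Suc q)
    then show ?thesis
      using rat_cong_0[OF p int[of q "r * (p - 1)"]] by (simp add: mult_ac)
  qed (simp add: rat_cong_refl p)
  ultimately show ?thesis by (simp add: reduces_to_def fps_inverse_fps_X_plus1)
qed

lemma reduces_to_power_mult:
  assumes "prime p" "reduces_to p G c" "reduces_to p H d"
  shows "reduces_to p (G ^ j * H) (c ^ j * d)"
  using assms by (induction j) (auto simp: mult.assoc intro: reduces_to_mult)

lemma one_plus_fps_X_power_nth: "((1 + fps_X) ^ j :: 'a :: comm_ring_1 fps) $ r = of_nat (j choose r)"
proof (induction j arbitrary: r)
  case 0
  show ?case by (cases r) simp_all
next
  case (Suc j)
  then show ?case by (cases r) (simp_all add: distrib_right)
qed

text \<open>With \<open>log(1 + X) = X * L\<close>, cancelling \<open>X^j\<close> moves the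
  coefficient of degree \<open>j + r * (p - 1)\<close> to degree \<open>r * (p - 1)\<close> in
  \<open>L^j / (1 + X)\<close>, a series that reduces to \<open>(1 + X)^j\<close>.\<close>

lemma stirling_coefficient_cong:
  assumes p: "prime p"
  shows "rat_cong (of_nat p ^ r * (of_int (signed_stirling (j + r * (p - 1) + 1) (j + 1)) *
      fact j / fact (j + r * (p - 1)))) (of_nat (j choose r)) p"
proof -
  define L :: "rat fps" where "L = Abs_fps (\<lambda>i. (-1) ^ i / of_nat (Suc i))"
  have "fps_ln 1 = fps_X * L"
    by (intro fps_ext) (simp add: L_def fps_ln_nth)
  then have "fps_ln 1 ^ j * inverse (1 + fps_X) = fps_X ^ j * (L ^ j * inverse (1 + fps_X))"
    by (simp only: power_mult_distrib mult.assoc)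
  then have "(L ^ j * inverse (1 + fps_X)) $ (r * (p - 1)) =
      (fps_ln 1 ^ j * inverse (1 + fps_X)) $ (j + r * (p - 1))"
    by (simp only: fps_X_power_mult_nth) simp
  moreover have "reduces_to p (L ^ j * inverse (1 + fps_X)) ((1 + fps_X) ^ j * 1)"
    unfolding L_def
    by (intro reduces_to_power_mult reduces_to_ln_over_X reduces_to_inverse_1_plus_X p)
  then have "rat_cong (of_nat p ^ r * (L ^ j * inverse (1 + fps_X)) $ (r * (p - 1)))
      (((1 + fps_X) ^ j * 1) $ r) p"
    unfolding reduces_to_def by blast
  ultimately show ?thesis
    by (simp only: fps_ln_power_over_1_plus_X_nth one_plus_fps_X_power_nth mult_1_right Suc_eq_plus1)
qed

section \<open>Legendre's formula\<close>

text \<open>Padding with zero digits allows numbers of different size to be summed over a common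
  range.\<close>

lemma digit_sum_extend:
  assumes "p \<ge> 2" "m \<le> N"
  shows "digit_sum p m = (\<Sum>i\<le>N. m div p ^ i mod p)"
  unfolding digit_sum_def
proof (rule sum.mono_neutral_left)
  show "\<forall>i\<in>{..N} - {..m}. m div p ^ i mod p = 0"
  proof
    fix i assume "i \<in> {..N} - {..m}"
    then have "m < i" by simp
    also have "i < 2 ^ i" by (rule less_exp)
    also have "2 ^ i \<le> p ^ i" using assms(1) by (rule power_mono) simp
    finally show "m div p ^ i mod p = 0" by simp
  qed
qed (use assms in auto)

lemma digit_sum_mult_add:
  assumes p: "p \<ge> 2" and d: "d < p"
  shows "digit_sum p (p * q + d) = d + digit_sum p q"
proof -
  have N: "q \<le> p * q + d" using p by (simp add: trans_le_add1)
  have "digit_sum p (p * q + d) = (\<Sum>i\<le>Suc (p * q + d). (p * q + d) div p ^ i mod p)"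
    by (rule digit_sum_extend[OF p]) simp
  also have "\<dots> = d + (\<Sum>i\<le>p * q + d. (p * q + d) div p ^ Suc i mod p)"
    using d by (subst sum.atMost_Suc_shift) simp
  also have "(\<Sum>i\<le>p * q + d. (p * q + d) div p ^ Suc i mod p) = (\<Sum>i\<le>p * q + d. q div p ^ i mod p)"
    using d by (simp add: div_mult2_eq)
  also have "\<dots> = digit_sum p q"
    by (rule digit_sum_extend[OF p N, symmetric])
  finally show ?thesis .
qed

text \<open>Adding 1 turns the trailing digits \<open>p - 1\<close> of \<open>m\<close> into zeros,
  as many as the valuation of \<open>m + 1\<close>, and raises the next digit by 1.\<close>

lemma digit_sum_Suc:
  assumes "prime p"
  shows "multiplicity p (Suc m) * (p - 1) + digit_sum p (Suc m) = Suc (digit_sum p m)"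
proof (induction m rule: less_induct)
  case (less m)
  have p: "p \<ge> 2" using assms by (rule prime_ge_2_nat)
  define q d where "q = m div p" and "d = m mod p"
  have m: "m = p * q + d" and d: "d < p" using p by (simp_all add: q_def d_def)
  show ?case
  proof (cases "Suc d < p")
    case True
    have "Suc m mod p = Suc d" using True m by simp
    then have "\<not> p dvd Suc m" by (metis dvd_eq_mod_eq_0 nat.distinct(2))
    then have "multiplicity p (Suc m) = 0" by (rule not_dvd_imp_multiplicity_0)
    moreover have "digit_sum p (Suc m) = Suc d + digit_sum p q"
      using digit_sum_mult_add[OF p True, of q] m by simp
    ultimately show ?thesis using digit_sum_mult_add[OF p d, of q] m by simp
  next
    \<comment> \<open>A carry: the last digit is \<open>p - 1\<close>, so \<open>m + 1\<close> is
      \<open>q + 1\<close> with a zero digit appended.\<close>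
    case False
    then have dp: "Suc d = p" using d by simp
    then have Sm: "Suc m = p * Suc q" using m by simp
    have "q < m"
      using mult_le_mono1[of 1 p q] m dp p by linarith
    from less.IH[OF this]
    have "multiplicity p (Suc q) * (p - 1) + digit_sum p (Suc q) = Suc (digit_sum p q)" .
    moreover have "multiplicity p (Suc m) = Suc (multiplicity p (Suc q))"
      unfolding Sm using p assms by (subst multiplicity_times_same) auto
    moreover have "digit_sum p (Suc m) = digit_sum p (Suc q)"
      using digit_sum_mult_add[OF p, of 0 "Suc q"] Sm p by simp
    moreover have "digit_sum p m = p - 1 + digit_sum p q"
      using digit_sum_mult_add[OF p d, of q] m dp by simp
    ultimately show ?thesis using p by simp
  qed
qed

text \<open>The identity for one step, summed over the factors of \<open>m!\<close>,
  telescopes.\<close>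

lemma legendre_digit_sum:
  assumes "prime p"
  shows "multiplicity p (fact m :: nat) * (p - 1) + digit_sum p m = m"
proof (induction m)
  case 0
  show ?case by (simp add: digit_sum_def)
next
  case (Suc m)
  have "multiplicity p (fact (Suc m) :: nat) = multiplicity p (Suc m) + multiplicity p (fact m :: nat)"
    unfolding fact_Suc of_nat_id using assms
    by (intro prime_elem_multiplicity_mult_distrib) auto
  then show ?case using Suc digit_sum_Suc[OF assms, of m] by (simp add: add_mult_distrib)
qed

lemma multiplicity_int_of_nat: "multiplicity (int p) (int m) = multiplicity p m"
  by (simp add: multiplicity_def flip: of_nat_power)

text \<open>The quotient is an integer, and \<open>V\<close> follows by subtracting Legendre's
  formula for \<open>j!\<close> from that for \<open>m!\<close>. The relation is stated additively
  to avoid truncated subtraction.\<close>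

lemma fact_quotient_valuation:
  assumes p: "prime p" and "j \<le> m"
  obtains V u :: nat where
    "padic_val p (fact m / fact j) = int V"
    "(fact m / fact j :: rat) = of_nat p ^ V * of_nat u"
    "V * (p - 1) + digit_sum p m + j = digit_sum p j + m"
proof -
  obtain F :: nat where F: "fact m = fact j * F"
    using fact_dvd[OF assms(2)] by (auto elim: dvdE)
  have F0: "F \<noteq> 0" using F by (metis fact_nonzero mult_0_right)
  have FQ: "(fact m / fact j :: rat) = of_nat F"
    using arg_cong[OF F, of "of_nat :: nat \<Rightarrow> rat"] by (simp add: field_simps)
  define V where "V = multiplicity p F"
  have "multiplicity p (fact m :: nat) = multiplicity p (fact j :: nat) + V"
    unfolding F V_def using p F0 by (intro prime_elem_multiplicity_mult_distrib) auto
  then have "V * (p - 1) + digit_sum p m + j = digit_sum p j + m"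
    using legendre_digit_sum[OF p, of m] legendre_digit_sum[OF p, of j]
    by (simp add: add_mult_distrib)
  moreover have "padic_val p (fact m / fact j) = int V"
    using padic_val_of_int[of p "int F"] by (simp add: FQ V_def multiplicity_int_of_nat)
  moreover obtain u where "F = p ^ V * u"
    using multiplicity_dvd[of p F] by (auto simp: V_def elim: dvdE)
  then have "(fact m / fact j :: rat) = of_nat p ^ V * of_nat u"
    by (simp add: FQ)
  ultimately show ?thesis using that by blast
qed

section \<open>Valuation and unit part in a minimum zero case\<close>

theorem theorem3p1:
  fixes p n k r :: nat
  assumes "prime p"
    and "1 \<le> k" and "k \<le> n"
    and "minimum_zero_case p n k"
    and "r = (n - k) div (p - 1)"
  shows "(of_int (padic_val p (of_int (signed_stirling n k))) :: rat) =
           (of_nat (digit_sum p (k - 1)) - of_nat (digit_sum p (n - 1))) / (of_nat p - 1)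
       \<and> rat_cong (unit_part p (of_int (signed_stirling n k)))
           (unit_part p (fact (n - 1) / fact (k - 1)) * of_nat ((k - 1) choose r)) p"
proof
  show val: "(of_int (padic_val p (of_int (signed_stirling n k))) :: rat) =
      (of_nat (digit_sum p (k - 1)) - of_nat (digit_sum p (n - 1))) / (of_nat p - 1)"
    using assms(4) by (simp add: minimum_zero_case_def)
  define j where "j = k - 1"
  have p2: "p \<ge> 2" using assms(1) by (rule prime_ge_2_nat)
  have "n - k = r * (p - 1)"
    using minimum_zero_case_dvd[OF assms(1-4)] assms(5) by simp
  then have n1: "n - 1 = j + r * (p - 1)" and n: "n = j + r * (p - 1) + 1" and k: "k = j + 1"
    using assms(2,3) by (simp_all add: j_def)
  obtain V u where V: "padic_val p (fact (n - 1) / fact j) = int V"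
    and u: "(fact (n - 1) / fact j :: rat) = of_nat p ^ V * of_nat u"
    and leg: "V * (p - 1) + digit_sum p (n - 1) + j = digit_sum p j + (n - 1)"
    using fact_quotient_valuation[OF assms(1), of j "n - 1"] n1 by (metis le_add1)
  define s :: rat where "s = of_int (signed_stirling n k)"
  \<comment> \<open>This is the coefficient of degree \<open>n - k\<close> in
    \<open>(log(1 + t)/t)^j / (1 + t)\<close>.\<close>
  define A where "A = s * fact j / fact (n - 1)"
  have sA: "s = fact (n - 1) / fact j * A" by (simp add: A_def)
  have cong: "rat_cong (of_nat p ^ r * A) (of_nat (j choose r)) p"
    using stirling_coefficient_cong[OF assms(1), of r j] unfolding A_def s_def n1
    by (simp add: n k)
  \<comment> \<open>By Legendre, the digit sums of \<open>k - 1\<close> and \<open>n - 1\<close>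
    differ by \<open>(V - r) * (p - 1)\<close>, so the minimum zero hypothesis prescribes exactly
    \<open>V - r\<close>.\<close>
  have "padic_val p s = int V - int r"
  proof -
    have "V * (p - 1) + digit_sum p (n - 1) = digit_sum p j + r * (p - 1)"
      using leg n1 by simp
    then have "(of_nat (V * (p - 1) + digit_sum p (n - 1)) :: rat) = of_nat (digit_sum p j + r * (p - 1))"
      by (simp only:)
    moreover have "(of_nat (p - 1) :: rat) = of_nat p - 1" using p2 by simp
    ultimately have "(of_nat (digit_sum p j) - of_nat (digit_sum p (n - 1)) :: rat) =
        (of_nat V - of_nat r) * (of_nat p - 1)"
      unfolding of_nat_add of_nat_mult by (simp only:) (simp add: algebra_simps)
    moreover have "(of_nat p - 1 :: rat) \<noteq> 0" using p2 by auto
    ultimately have "(of_int (padic_val p s) :: rat) = of_int (int V - int r)"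
      using val by (simp add: s_def j_def)
    then show ?thesis by (simp only: of_int_eq_iff)
  qed
  moreover have "s = of_nat p ^ V * of_nat u * A" unfolding sA u ..
  moreover have p0: "(of_nat p :: rat) \<noteq> 0" using p2 by simp
  \<comment> \<open>Dividing \<open>p^V * u * A\<close> by \<open>p^(V - r)\<close> leaves
    \<open>p^r * A\<close>, which is congruent to the binomial coefficient, times the integer
    \<open>u\<close>.\<close>
  ultimately have "unit_part p s = of_nat u * (of_nat p ^ r * A)"
    by (simp add: unit_part_def power_int_diff)
  moreover have "unit_part p (fact (n - 1) / fact j) = of_nat u"
    unfolding unit_part_def V unfolding u using p0 by (simp add: power_int_minus)
  moreover have "rat_cong (of_nat u * (of_nat p ^ r * A)) (of_nat u * of_nat (j choose r)) p"
    by (rule rat_cong_mult_left[OF assms(1) p_integral_of_nat[OF assms(1)] cong])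
  ultimately show "rat_cong (unit_part p (of_int (signed_stirling n k)))
      (unit_part p (fact (n - 1) / fact (k - 1)) * of_nat ((k - 1) choose r)) p"
    by (simp add: s_def j_def)
qed

end
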